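(* Let $n<\omega$ and let $X$ be a set with $|X|\geq\aleph_n$. If $\mathcal F$ is a family of finite subsets of $X$ such that every finite subset of $X$ is contained in some member of $\mathcal F$, then the VC-dimension of $\mathcal F$ is $>n$. Consequently, if $|X|\geq\aleph_\omega$, any such family $\mathcal F$ has infinite VC-dimension (i.e., $\mathcal F$ is not a VC-class).
   Context: For a set $X$ and $\mathcal F\subseteq\mathcal P(X)$, a subset $A\subseteq X$ is shattered by $\mathcal F$ if for every $S\subseteq A$ there is $F\in\mathcal F$ with $F\cap A=S$. $\mathcal F$ is a VC-class if for some $n<\omega$ no subset of $X$ of size $n$ is shattered; its VC-dimension is then the smallest $n$ such that no subset of size $n+1$ is shattered, and it is $\infty$ if no such $n$ exists. *)

theory Defs
  imports Main "HOL-Library.Extended_Nat"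
begin

unbundle cardinal_syntax

definition shattered :: "'a set set \<Rightarrow> 'a set \<Rightarrow> bool" where
  "shattered F A \<longleftrightarrow> (\<forall>S\<subseteq>A. \<exists>B\<in>F. B \<inter> A = S)"

definition shatters_some_of_size :: "'a set \<Rightarrow> 'a set set \<Rightarrow> nat \<Rightarrow> bool" where
  "shatters_some_of_size X F n \<longleftrightarrow>
     (\<exists>A\<subseteq>X. finite A \<and> card A = n \<and> shattered F A)"

definition vc_class :: "'a set \<Rightarrow> 'a set set \<Rightarrow> bool" where
  "vc_class X F \<longleftrightarrow> (\<exists>n. \<not> shatters_some_of_size X F n)"

definition vc_dim :: "'a set \<Rightarrow> 'a set set \<Rightarrow> enat" where
  "vc_dim X F =
     (if vc_class X F then enat (LEAST n. \<not> shatters_some_of_size X F (n + 1)) else \<infinity>)"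

text \<open>
  \<open>cardSuc\<close> maps a relation on \<open>'a\<close> to one on \<open>'a set\<close>, so it cannot be iterated within a single
  type, and there need not be a type that is large enough for all alephs. Hence \<open>\<aleph>\<^sub>n\<close> is rendered as
  a property of cardinals \<open>r\<close> on a given type: \<open>is_aleph n r\<close> says that \<open>r\<close> is a
  cardinal equal to \<open>\<aleph>\<^sub>n\<close>. Restricting the predecessor \<open>s\<close> to the same type as \<open>r\<close> loses nothing,
  because a type that carries \<open>\<aleph>\<^sub>n\<^sub>+\<^sub>1\<close> also carries \<open>\<aleph>\<^sub>n\<close>.
\<close>

primrec is_aleph :: "nat \<Rightarrow> 'a rel \<Rightarrow> bool" where
  "is_aleph 0 r \<longleftrightarrow> Card_order r \<and> r =o natLeq"
| "is_aleph (Suc n) r \<longleftrightarrow> Card_order r \<and> (\<exists>s :: 'a rel. is_aleph n s \<and> r =o cardSuc s)"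

lemma is_aleph_unique:
  fixes r :: "'a rel" and s :: "'b rel"
  assumes "is_aleph n r" and "is_aleph n s"
  shows "r =o s"
  using assms
proof (induction n arbitrary: r s)
  case 0
  then show ?case
    by (auto intro: ordIso_transitive ordIso_symmetric)
next
  case (Suc n)
  then obtain r' :: "'a rel" and s' :: "'b rel"
    where r': "is_aleph n r'" "r =o cardSuc r'" and s': "is_aleph n s'" "s =o cardSuc s'"
    by auto
  have "Card_order r'" "Card_order s'"
    using r'(1) s'(1) by (cases n; simp)+
  then have "cardSuc r' =o cardSuc s'"
    using Suc.IH[OF r'(1) s'(1)] by (simp add: cardSuc_invar_ordIso)
  then show ?case
    using r'(2) s'(2) by (meson ordIso_symmetric ordIso_transitive)
qed

definition aleph_le :: "nat \<Rightarrow> 'a rel \<Rightarrow> bool" where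
  "aleph_le n t \<longleftrightarrow> (\<exists>r :: 'a rel. is_aleph n r \<and> r \<le>o t)"

text \<open>
  \<open>\<aleph>\<^sub>\<omega>\<close> is the least cardinal above all \<open>\<aleph>\<^sub>n\<close>.
\<close>

definition is_aleph_omega :: "'a rel \<Rightarrow> bool" where
  "is_aleph_omega r \<longleftrightarrow>
     Card_order r \<and> (\<forall>n. aleph_le n r) \<and>
     (\<forall>t :: 'a rel. Card_order t \<and> (\<forall>n. aleph_le n t) \<longrightarrow> r \<le>o t)"

definition aleph_omega_le :: "'a rel \<Rightarrow> bool" where
  "aleph_omega_le t \<longleftrightarrow> (\<exists>r :: 'a rel. is_aleph_omega r \<and> r \<le>o t)"

end

theory Submission
  imports Defs "HOL-Algebra.Free_Abelian_Groups"
begin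

text \<open>
  Choose for every finite \<open>S \<subseteq> X\<close> a member \<open>g S \<supseteq> S\<close> of the family. A set \<open>A\<close> with
  \<open>g S \<inter> A \<subseteq> S\<close> for all \<open>S \<subseteq> A\<close> is shattered, and such a free set of size \<open>n + 1\<close>
  exists for every finite-set-valued \<open>g\<close> once \<open>|X| \<ge> \<aleph>\<^sub>n\<close> (Kuratowski). For the induction step, take
  \<open>Y \<subseteq> X\<close> of size \<open>\<aleph>\<^sub>n\<close> and a point \<open>x\<close> outside \<open>Y\<close> and outside all \<open>g S\<close>
  with \<open>S \<subseteq> Y\<close> finite. If \<open>A \<subseteq> Y\<close> is free for \<open>S \<mapsto> g S \<union> g (S \<union> {x})\<close>, then \<open>A \<union> {x}\<close>
  is free for \<open>g\<close>.
\<close>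

lemma is_aleph_Card_order: "is_aleph n r \<Longrightarrow> Card_order r"
  by (cases n) auto

lemma is_aleph_infinite_Field: "is_aleph n r \<Longrightarrow> infinite (Field r)"
proof (induction n arbitrary: r)
  case 0
  then have "|Field r| =o |Field natLeq|"
    by (auto intro: card_of_cong)
  then show ?case
    using card_of_ordIso_finite[of "Field r"] by (simp add: Field_natLeq)
next
  case (Suc n)
  then obtain s :: "'a rel" where s: "is_aleph n s" "r =o cardSuc s" "Card_order r"
    by auto
  then have "infinite (Field (cardSuc s))"
    using Suc.IH is_aleph_Card_order cardSuc_finite by blast
  then show ?case
    using s is_aleph_Card_order cardSuc_Card_order card_of_cong card_of_ordIso_finite by blast
qed

lemma aleph_le_trans:
  fixes r t :: "'a rel"
  shows "aleph_le n r \<Longrightarrow> r \<le>o t \<Longrightarrow> aleph_le n t"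
  unfolding aleph_le_def using ordLeq_transitive by blast

lemma aleph_le_infinite: "aleph_le n |X| \<Longrightarrow> infinite X"
  unfolding aleph_le_def
  by (metis Card_order_iff_ordIso_card_of card_of_Card_order card_of_ordLeq_infinite Field_card_of
      card_of_mono2 is_aleph_infinite_Field)

text \<open>The cardinal \<open>s\<close> whose successor is at most \<open>|X|\<close> lies
  strictly below \<open>|X|\<close>, so its field embeds into \<open>X\<close>; the image is taken
  as \<open>Y\<close>.\<close>

lemma aleph_le_Suc_obtain_subset:
  fixes X :: "'a set"
  assumes "aleph_le (Suc n) |X|"
  obtains Y where "Y \<subseteq> X" "aleph_le n |Y|" "|Y| <o |X|"
proof -
  obtain r s :: "'a rel" where s: "is_aleph n s" and r: "r =o cardSuc s" "r \<le>o |X|"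
    using assms unfolding aleph_le_def by auto
  have card: "Card_order s"
    using s by (rule is_aleph_Card_order)
  have less: "s <o |X|"
    using cardSuc_greater[OF card] r by (meson ordIso_symmetric ordLess_ordIso_trans ordLess_ordLeq_trans)
  have iso: "|Field s| =o s"
    using card by (rule card_of_Field_ordIso)
  then have "|Field s| \<le>o |X|"
    using less ordIso_ordLess_trans ordLess_imp_ordLeq by blast
  then obtain f where f: "inj_on f (Field s)" "f ` Field s \<subseteq> X"
    using card_of_ordLeq[of "Field s" X] by blast
  have "|Field s| =o |f ` Field s|"
    using f(1) card_of_ordIso inj_on_imp_bij_betw by blast
  then have "s =o |f ` Field s|"
    using iso ordIso_symmetric ordIso_transitive by blast
  then have "aleph_le n |f ` Field s|" "|f ` Field s| <o |X|"
    using s less unfolding aleph_le_def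
    by (blast dest: ordIso_imp_ordLeq ordIso_symmetric intro: ordIso_ordLess_trans)+
  with f(2) that show thesis by blast
qed

text \<open>An infinite set has only as many finite subsets as elements, so this is a union of at
  most \<open>|Y|\<close> sets, each finite.\<close>

lemma card_of_UNION_Fpow_le:
  assumes "infinite Y" and "\<And>S. S \<in> Fpow Y \<Longrightarrow> finite (g S)"
  shows "|\<Union>S\<in>Fpow Y. g S| \<le>o |Y|"
proof (rule card_of_UNION_ordLeq_infinite[OF assms(1)])
  show "|Fpow Y| \<le>o |Y|"
    using assms(1) card_of_Fpow_infinite ordIso_imp_ordLeq by blast
  show "\<forall>S\<in>Fpow Y. |g S| \<le>o |Y|"
    using assms finite_ordLess_infinite2 ordLess_imp_ordLeq by blast
qed

lemma Kuratowski_free_set: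
  assumes "aleph_le n |X|" and "\<And>S. S \<in> Fpow X \<Longrightarrow> finite (g S)"
  shows "\<exists>A\<subseteq>X. finite A \<and> card A = Suc n \<and> (\<forall>S\<subseteq>A. g S \<inter> A \<subseteq> S)"
  using assms
\<comment> \<open>Both \<open>X\<close> and \<open>g\<close> vary, since the step passes to a
  smaller set and an enlarged function.\<close>
proof (induction n arbitrary: X g)
  case 0
  have "infinite X" "finite (g {})"
    using 0 aleph_le_infinite by (auto simp: Fpow_def)
  then obtain x where "x \<in> X" "x \<notin> g {}"
    by (meson finite_subset subsetI)
  \<comment> \<open>Only the subset \<open>{}\<close> imposes a condition on \<open>{x}\<close>,
    namely that \<open>x\<close> avoid \<open>g {}\<close>.\<close>
  then show ?case
    by (intro exI[of _ "{x}"]) (auto simp: subset_singleton_iff)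
next
  case (Suc n)
  obtain Y where Y: "Y \<subseteq> X" "aleph_le n |Y|" "|Y| <o |X|"
    using Suc.prems(1) by (rule aleph_le_Suc_obtain_subset)
  have inf: "infinite Y"
    using Y(2) by (rule aleph_le_infinite)
  have fin: "finite (g S)" if "S \<in> Fpow Y" for S
    using that Y(1) Suc.prems(2) by (auto simp: Fpow_def)
  have fin_insert: "finite (g (insert x S))" if "S \<in> Fpow Y" "x \<in> X" for S x
    using that Y(1) Suc.prems(2) by (auto simp: Fpow_def)
  have "infinite X"
    using inf Y(1) finite_subset by blast
  moreover have "|\<Union>S\<in>Fpow Y. g S| <o |X|"
    using card_of_UNION_Fpow_le[OF inf fin] Y(3) by (rule ordLeq_ordLess_trans)
  \<comment> \<open>Two sets of size below the infinite cardinal \<open>|X|\<close> have a union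
    below it as well, so they cannot cover \<open>X\<close>.\<close>
  ultimately have "|Y \<union> (\<Union>S\<in>Fpow Y. g S)| <o |X|"
    using Y(3) card_of_Un_ordLess_infinite by blast
  then have "\<not> X \<subseteq> Y \<union> (\<Union>S\<in>Fpow Y. g S)"
    using card_of_mono1 not_ordLess_ordLeq by blast
  then obtain x where x: "x \<in> X" "x \<notin> Y" "\<And>S. S \<in> Fpow Y \<Longrightarrow> x \<notin> g S"
    by blast
  obtain A where A: "A \<subseteq> Y" "finite A" "card A = Suc n"
      and free: "\<And>S. S \<subseteq> A \<Longrightarrow> (g S \<union> g (insert x S)) \<inter> A \<subseteq> S"
    using Suc.IH[OF Y(2), of "\<lambda>S. g S \<union> g (insert x S)"] fin fin_insert x(1) by auto
  have "g S \<inter> insert x A \<subseteq> S" if S: "S \<subseteq> insert x A" for S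
  proof (cases "x \<in> S")
    case True
    \<comment> \<open>Here the summand \<open>g (insert x _)\<close> is used: at
      \<open>S - {x}\<close> it equals \<open>g S\<close>, which therefore meets \<open>A\<close>
      inside \<open>S - {x}\<close>.\<close>
    then have "insert x (S - {x}) = S" "S - {x} \<subseteq> A"
      using S by auto
    with free[of "S - {x}"] True show ?thesis by auto
  next
    case False
    with S have "S \<subseteq> A" by blast
    moreover from this A have "S \<in> Fpow Y"
      by (auto simp: Fpow_def intro: finite_subset)
    ultimately show ?thesis
      \<comment> \<open>Freeness controls the part of \<open>g S\<close> in \<open>A\<close>, and
        the choice of \<open>x\<close> keeps \<open>x\<close> out of \<open>g S\<close>.\<close>
      using free[of S] x(3) by auto
  qed
  moreover have "x \<notin> A"
    using A(1) x(2) by blast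
  then have "insert x A \<subseteq> X" "finite (insert x A)" "card (insert x A) = Suc (Suc n)"
    using A x Y(1) by auto
  ultimately show ?case by blast
qed

lemma shattered_subset:
  assumes "shattered F A" and "B \<subseteq> A"
  shows "shattered F B"
  unfolding shattered_def
proof (intro allI impI)
  fix S assume "S \<subseteq> B"
  with assms obtain C where "C \<in> F" "C \<inter> A = S"
    unfolding shattered_def by blast
  with \<open>S \<subseteq> B\<close> assms(2) show "\<exists>C\<in>F. C \<inter> B = S" by blast
qed

lemma shatters_some_of_size_antimono:
  assumes "shatters_some_of_size X F n" and "m \<le> n"
  shows "shatters_some_of_size X F m"
proof -
  obtain A where A: "A \<subseteq> X" "finite A" "card A = n" "shattered F A"
    using assms(1) unfolding shatters_some_of_size_def by blast
  obtain B where "B \<subseteq> A" "card B = m" "finite B"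
    using obtain_subset_with_card_n[of m A] assms(2) A(3) by blast
  moreover from this A have "B \<subseteq> X" "shattered F B"
    using shattered_subset by auto
  ultimately show ?thesis
    unfolding shatters_some_of_size_def by auto
qed

text \<open>The sizes of shattered sets are closed downwards, so the least \<open>m\<close> for
  which size \<open>m + 1\<close> fails exceeds \<open>n\<close> exactly when size
  \<open>n + 1\<close> occurs. Outside the VC-classes every size occurs and the dimension is
  infinite.\<close>

lemma less_vc_dim_iff: "enat n < vc_dim X F \<longleftrightarrow> shatters_some_of_size X F (Suc n)"
proof (cases "vc_class X F")
  case True
  let ?P = "\<lambda>m. \<not> shatters_some_of_size X F (m + 1)"
  \<comment> \<open>The size that fails by \<open>vc_class\<close> may be 0, as for empty
    \<open>F\<close>; antimonotonicity moves the failure up to a successor.\<close>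
  obtain m where "?P m"
    using True shatters_some_of_size_antimono unfolding vc_class_def by (meson le_add1)
  then have least: "?P (Least ?P)"
    by (rule LeastI)
  have "n < Least ?P \<longleftrightarrow> \<not> ?P n"
    using least not_less_Least shatters_some_of_size_antimono
    by (metis add_le_mono1 not_le_imp_less)
  with True show ?thesis
    by (simp add: vc_dim_def)
next
  case False
  then show ?thesis
    by (simp add: vc_dim_def vc_class_def)
qed

lemma cofinal_shatters_aleph:
  assumes "F \<subseteq> Fpow X" and "\<forall>A\<in>Fpow X. \<exists>B\<in>F. A \<subseteq> B" and "aleph_le n |X|"
  shows "shatters_some_of_size X F (Suc n)"
proof -
  obtain g where g: "\<And>S. S \<in> Fpow X \<Longrightarrow> g S \<in> F \<and> S \<subseteq> g S"
    using assms(2) by metis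
  then have "finite (g S)" if "S \<in> Fpow X" for S
    using that assms(1) by (auto simp: Fpow_def)
  then obtain A where A: "A \<subseteq> X" "finite A" "card A = Suc n"
      and free: "\<And>S. S \<subseteq> A \<Longrightarrow> g S \<inter> A \<subseteq> S"
    using Kuratowski_free_set[OF assms(3), of g] by blast
  have "\<exists>B\<in>F. B \<inter> A = S" if "S \<subseteq> A" for S
  proof -
    have "S \<in> Fpow X"
      using that A by (auto simp: Fpow_def intro: finite_subset)
    \<comment> \<open>The witness is \<open>g S\<close>: it contains \<open>S\<close> by choice, and
      freeness bounds its trace on \<open>A\<close> by \<open>S\<close>.\<close>
    with g[of S] free[OF that] that show ?thesis by blast
  qed
  with A show ?thesis
    unfolding shatters_some_of_size_def shattered_def by blast
qed

theorem proposition3p3: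
  fixes X :: "'a set" and F :: "'a set set"
  assumes "F \<subseteq> Fpow X"
    and "\<forall>A\<in>Fpow X. \<exists>B\<in>F. A \<subseteq> B"
  shows "(\<forall>n. aleph_le n |X| \<longrightarrow> vc_dim X F > enat n) \<and>
         (aleph_omega_le |X| \<longrightarrow> vc_dim X F = \<infinity> \<and> \<not> vc_class X F)"
proof (intro conjI impI allI)
  fix n
  assume "aleph_le n |X|"
  then show "vc_dim X F > enat n"
    using cofinal_shatters_aleph[OF assms] by (simp add: less_vc_dim_iff)
next
  assume "aleph_omega_le |X|"
  then have "aleph_le n |X|" for n
    unfolding aleph_omega_le_def is_aleph_omega_def using aleph_le_trans by blast
  then have "shatters_some_of_size X F n" for n
    \<comment> \<open>A shattered set of size \<open>Suc n\<close> gives one of size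
      \<open>n\<close>, so size 0 is covered too.\<close>
    using cofinal_shatters_aleph[OF assms] shatters_some_of_size_antimono by (meson le_SucI order_refl)
  then show "\<not> vc_class X F"
    by (simp add: vc_class_def)
  then show "vc_dim X F = \<infinity>"
    by (simp add: vc_dim_def)
qed

end
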